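(* Let $k\ge 2$ and $l\ge 2$ be fixed integers and $n\to\infty$. If $2\le l<2k$, then $$ex(n,P_l,C_{2k})\ge (1+o(1))\frac12 (k-1)_{\lfloor l/2\rfloor}\, n^{\lceil l/2\rceil}.$$ If $l\ge 2k$, then $$ex(n,P_l,C_{2k})\ge (1+o(1))\max\left\{\left(\frac{n}{\lfloor l/2\rfloor}\right)^{\lceil l/2\rceil},\ \left(\frac{k-1}{4(k-2)^{k+2}}\right)^{\lceil l/2\rceil}(k-1)_{\lfloor l/2\rfloor}\, n^{\lceil l/2\rceil}\right\}.$$
   Context: $C_k$ denotes the cycle with $k$ vertices and $P_l$ the path with $l$ vertices. $ex(n,H,F)$ is the maximum number of subgraphs isomorphic to $H$ in an $n$-vertex graph containing no subgraph isomorphic to $F$. For positive integers $m,j$, $(m)_j=m(m-1)\cdots(m-j+1)$. *)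

theory Defs
  imports Complex_Main
begin

definition simple_graph :: "nat \<Rightarrow> nat set set \<Rightarrow> bool" where
  "simple_graph n E \<longleftrightarrow> (\<forall>e\<in>E. card e = 2 \<and> e \<subseteq> {..<n})"

text \<open>Copies of the path P_l (l vertices) in G, each identified with its edge set
  (for l \<ge> 2 a path has no isolated vertices, so a subgraph isomorphic to P_l is
  determined by its edge set).\<close>
definition path_copies :: "nat set set \<Rightarrow> nat \<Rightarrow> nat set set set" where
  "path_copies E l = {{{v i, v (Suc i)} | i. Suc i < l} | v.
      inj_on v {..<l} \<and> (\<forall>i. Suc i < l \<longrightarrow> {v i, v (Suc i)} \<in> E)}"

definition has_cycle :: "nat set set \<Rightarrow> nat \<Rightarrow> bool" where
  "has_cycle E m \<longleftrightarrow> (\<exists>v::nat \<Rightarrow> nat. inj_on v {..<m} \<and>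
      (\<forall>i<m. {v i, v ((Suc i) mod m)} \<in> E))"

definition ex_path_cycle :: "nat \<Rightarrow> nat \<Rightarrow> nat \<Rightarrow> nat" where
  "ex_path_cycle n l m = Max {card (path_copies E l) | E. simple_graph n E \<and> \<not> has_cycle E m}"

definition ffac :: "real \<Rightarrow> nat \<Rightarrow> real" where
  "ffac m j = (\<Prod>i<j. (m - real i))"

end

theory Submission
  imports Defs "HOL-Number_Theory.Prime_Powers" "HOL-Number_Theory.Cong" "HOL-Real_Asymp.Real_Asymp"
begin

text \<open>
  If \<open>l \<ge> 2 k\<close> then \<open>(k - 1)\<^sub>j\<close> vanishes for \<open>j = \<lfloor>l / 2\<rfloor> \<ge> k\<close>, so only the first term of the
  maximum matters. Write \<open>m = \<lfloor>l / 2\<rfloor>\<close>. Three graphs give the bounds. In each of them one counts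
  vertex sequences greedily; a path arises from two sequences, which costs a factor two.

  \<^item> For \<open>l < 2 k\<close>: the complete bipartite graph with parts of size \<open>k - 1\<close> and \<open>n - k + 1\<close>.

  \<^item> For \<open>l \<ge> 2 k\<close>, \<open>k \<ge> 3\<close>: replace each edge of a path on \<open>m\<close> vertices by about \<open>n / (m - 1)\<close>
    paths of length two. All cycles of this graph have length four, and it has at least
    \<open>(n / (m - 1))\<^sup>d / 2\<close> paths with \<open>l\<close> vertices, where \<open>d = \<lceil>l / 2\<rceil>\<close>; by Bernoulli's inequality
    this is at least \<open>(n / m)\<^sup>d\<close>.

  \<^item> For \<open>l \<ge> 2 k\<close>, \<open>k = 2\<close>: the graph on points of the affine plane over a prime field in which
    \<open>(x, y)\<close> and \<open>(x', y')\<close> are adjacent if \<open>y + y' = x x'\<close>. It contains no four-cycle, and using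
    \<open>s\<close> of the \<open>p\<close> vertical lines gives about \<open>p s\<^sup>l / 2\<close> paths. A prime between \<open>0.8 \<surd>n\<close> and
    \<open>1.4 \<surd>n\<close> yields the required constant even for \<open>l = 5\<close>, the tightest case; Bertrand's
    postulate, with ratio 2 in place of 7/4, would not be enough. Chebyshev's method applied to \<open>(6 n)! / ((3 n)! (2 n)! n!)\<close> suffices.
\<close>

section \<open>Primes in intervals of ratio 7/4\<close>

text \<open>Chebyshev's second function: each prime power \<open>p ^ j \<le> N\<close> contributes
  \<open>ln p\<close>.\<close>

definition psi :: "nat \<Rightarrow> real" where
  "psi N = (\<Sum>d=1..N. mangoldt d)"

lemma psi_nonneg: "psi N \<ge> 0"
  unfolding psi_def by (intro sum_nonneg mangoldt_nonneg)

lemma psi_mono: "M \<le> N \<Longrightarrow> psi M \<le> psi N"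
  unfolding psi_def by (intro sum_mono2) (auto simp: mangoldt_nonneg)

text \<open>Passing from \<open>n\<close> to \<open>Suc n\<close> adds \<open>ln (Suc n)\<close>,
  the sum of \<open>mangoldt\<close> over the divisors of \<open>Suc n\<close>, and
  \<open>n div d\<close> grows by one at exactly these \<open>d\<close>. The free upper limit
  \<open>N\<close> lets several factorials be expanded over one common range.\<close>

lemma ln_fact_eq_sum_mangoldt:
  assumes "n \<le> N"
  shows "ln (fact n) = (\<Sum>d=1..N. mangoldt d * real (n div d))"
  using assms
proof (induction n)
  case 0
  then show ?case by simp
next
  case (Suc n)
  have div_Suc: "real (Suc n div d) = real (n div d) + (if d dvd Suc n then 1 else 0)" for d
    by (auto simp: div_Suc dvd_eq_mod_eq_0)
  have "ln (fact (Suc n)) = ln (real (Suc n)) + ln (fact n :: real)"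
    by (simp add: ln_mult del: of_nat_Suc)
  also have "ln (real (Suc n)) = (\<Sum>d | d dvd Suc n. mangoldt d)"
    using mangoldt_sum[of "Suc n", where 'a = real] by simp
  also have "{d. d dvd Suc n} = {d \<in> {1..N}. d dvd Suc n}"
    using Suc.prems by (auto dest: dvd_imp_le intro: Nat.gr0I simp: Suc_le_eq)
  also have "(\<Sum>d\<in>{d \<in> {1..N}. d dvd Suc n}. mangoldt d) =
      (\<Sum>d=1..N. if d dvd Suc n then mangoldt d else (0::real))"
    by (rule sum.inter_filter) simp
  also have "\<dots> + ln (fact n) = (\<Sum>d=1..N. mangoldt d * real (Suc n div d))"
    using Suc by (simp add: div_Suc sum.distrib [symmetric] algebra_simps if_distrib cong: if_cong)
  finally show ?case .
qed

section \<open>Growth of the multinomial coefficient with parts 3n, 2n, n\<close>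

definition multinomial321 :: "nat \<Rightarrow> real" where
  "multinomial321 n = fact (6 * n) / (fact (3 * n) * fact (2 * n) * fact n)"

lemma multinomial321_pos: "multinomial321 n > 0"
  by (simp add: multinomial321_def)

text \<open>Up to constants, of the six new factors of \<open>fact (6 * Suc n)\<close> all but
  \<open>6 n + 1\<close> and \<open>6 n + 5\<close> cancel against the denominator. The ratio of
  consecutive terms therefore tends to 432.\<close>

lemma multinomial321_Suc:
  "multinomial321 (Suc n) * real (Suc n) ^ 2 = 12 * (36 * real n ^ 2 + 36 * real n + 5) * multinomial321 n"
proof -
  have 6: "fact (6 * Suc n) = 72 * real (Suc n) * (6 * real n + 5) * (3 * real n + 2) * (2 * real n + 1)
     * (3 * real n + 1) * (6 * real n + 1) * (fact (6 * n) :: real)"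
    by (simp add: fact_reduce eval_nat_numeral field_simps)
  have 3: "fact (3 * Suc n) = 3 * real (Suc n) * (3 * real n + 2) * (3 * real n + 1) * (fact (3 * n) :: real)"
    by (simp add: fact_reduce eval_nat_numeral field_simps)
  have 2: "fact (2 * Suc n) = 2 * real (Suc n) * (2 * real n + 1) * (fact (2 * n) :: real)"
    by (simp add: fact_reduce eval_nat_numeral field_simps)
  have 1: "fact (Suc n) = real (Suc n) * (fact n :: real)"
    by simp
  define a b c d where "a = real (Suc n)" "b = 3 * real n + 2" "c = 3 * real n + 1" "d = 2 * real n + 1"
  have nz: "a \<noteq> 0" "b \<noteq> 0" "c \<noteq> 0" "d \<noteq> 0"
    by (simp_all add: a_b_c_d_def)
  have "multinomial321 (Suc n) * real (Suc n) ^ 2 = 12 * ((6 * real n + 5) * (6 * real n + 1)) * multinomial321 n"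
    unfolding multinomial321_def 6 3 2 1 a_b_c_d_def [symmetric]
    using nz by (simp add: field_simps power2_eq_square)
  also have "(6 * real n + 5) * (6 * real n + 1) = 36 * real n ^ 2 + 36 * real n + 5"
    by (simp add: field_simps power2_eq_square)
  finally show ?thesis .
qed

text \<open>The ratio of consecutive terms is at most 432, as
  \<open>36 n^2 + 36 n + 5 \<le> 36 (n + 1)^2\<close>.\<close>

lemma multinomial321_le: "multinomial321 n \<le> 432 ^ n"
proof (induction n)
  case 0
  then show ?case by (simp add: multinomial321_def)
next
  case (Suc n)
  have "multinomial321 (Suc n) * real (Suc n) ^ 2 = 12 * (36 * real n ^ 2 + 36 * real n + 5) * multinomial321 n"
    by (rule multinomial321_Suc)
  also have "\<dots> \<le> 12 * (36 * real (Suc n) ^ 2) * 432 ^ n"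
    using Suc multinomial321_pos[of n]
    by (intro mult_mono) (auto simp: power2_eq_square algebra_simps)
  finally have "multinomial321 (Suc n) * real (Suc n) ^ 2 \<le> 432 ^ Suc n * real (Suc n) ^ 2"
    by (simp add: mult_ac)
  then show ?case by (simp add: mult_le_cancel_right del: of_nat_Suc)
qed

text \<open>Dropping the 5 in the recurrence bounds the ratio of consecutive terms below by
  \<open>432 n / (n + 1)\<close>, so \<open>n * multinomial321 n / 432 ^ n\<close> does not
  decrease. At \<open>n = 1\<close> the claim is \<open>432 \<le> 480\<close>.\<close>

lemma multinomial321_ge: "432 ^ n \<le> 8 * real n * multinomial321 n" if "n \<ge> 1"
  using that
proof (induction n rule: nat_induct_at_least)
  case base
  show ?case by (simp add: multinomial321_def fact_numeral)
next
  case (Suc n)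
  have "432 ^ Suc n * real (Suc n) \<le> 432 * (8 * real n * multinomial321 n) * real (Suc n)"
    using Suc by (simp add: mult_ac del: of_nat_Suc)
  also have "\<dots> = 8 * (12 * (36 * real n ^ 2 + 36 * real n)) * multinomial321 n"
    by (simp add: power2_eq_square algebra_simps)
  also have "\<dots> \<le> 8 * (12 * (36 * real n ^ 2 + 36 * real n + 5)) * multinomial321 n"
    using multinomial321_pos[of n] by (intro mult_right_mono) auto
  also have "\<dots> = (8 * real (Suc n) * multinomial321 (Suc n)) * real (Suc n)"
    using multinomial321_Suc[of n] by (simp only: power2_eq_square mult_ac)
  finally show ?case by (subst (asm) mult_le_cancel_right) (simp del: of_nat_Suc power_Suc)
qed

text \<open>The weights depend only on \<open>6 n / d\<close> modulo 6: they are 0 on \<open>[0, 1)\<close>,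
  1 on \<open>[1, 5)\<close> and 2 on \<open>[5, 6)\<close>.\<close>

lemma chebyshev_weights:
  fixes n d :: nat
  assumes "d \<ge> 1"
  defines "f \<equiv> int (6 * n div d) - int (3 * n div d) - int (2 * n div d) - int (n div d)"
  shows "f \<ge> 0" "f \<le> 2" "n < d \<Longrightarrow> d \<le> 6 * n \<Longrightarrow> f \<ge> 1"
    "6 * n < 5 * d \<Longrightarrow> f \<le> 1" 
proof -
  define q r where "q = n div d" and "r = n mod d"
  have n: "n = d * q + r" and r: "r < d"
    using assms by (auto simp: q_def r_def)
  have D: "(c * n) div d = c * q + (c * r) div d" for c
    using assms unfolding n by (simp add: algebra_simps div_add1_eq) 
  have f: "f = int (6 * r div d) - int (3 * r div d) - int (2 * r div d)"
    unfolding f_def D using D[of 1] r by simp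
  have bnd: "d * (c * r div d) \<le> c * r" "c * r < d * (c * r div d) + d" for c
    using assms dividend_less_times_div[of d "c * r"] by simp_all
  have lt: "c * r div d < c" if "c > 0" for c
    using r that assms by (intro less_mult_imp_div_less) auto
  define x6 x3 x2 where x: "x6 = 6 * r div d" "x3 = 3 * r div d" "x2 = 2 * r div d"
  have "x3 < 3" "x2 < 2" "x6 < 6" using lt[of 3] lt[of 2] lt[of 6] by (auto simp: x)
  \<comment> \<open>With finitely many values for the three quotients, each claim splits into
    finitely many linear problems in \<open>r\<close> and \<open>d\<close>.\<close>
  then have c: "x3 \<in> {0,1,2}" "x2 \<in> {0,1}" "x6 \<in> {0,1,2,3,4,5}" by auto
  have b: "d * x6 \<le> 6 * r" "6 * r < d * x6 + d" "d * x3 \<le> 3 * r" "3 * r < d * x3 + d"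
     "d * x2 \<le> 2 * r" "2 * r < d * x2 + d"
    using bnd[of 6] bnd[of 3] bnd[of 2] by (auto simp: x)
  have f': "f = int x6 - int x3 - int x2" using f by (simp add: x)
  show "f \<ge> 0" "f \<le> 2" using c b unfolding f' by (elim insertE emptyE; simp)+
  show "f \<ge> 1" if "n < d" "d \<le> 6 * n"
  proof -
    have "r = n" using that by (simp add: r_def)
    then show ?thesis using that c b unfolding f' by (elim insertE emptyE; simp)
  qed
  show "f \<le> 1" if "6 * n < 5 * d"
  proof -
    have "6 * r < 5 * d" using that n r by simp
    then show ?thesis using c b unfolding f' by (elim insertE emptyE; simp)
  qed
qed

section \<open>Chebyshev bounds for psi\<close>

lemma ln_multinomial321_eq_sum_mangoldt:
  "ln (multinomial321 n) = (\<Sum>d=1..6*n. mangoldt d *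
     real_of_int (int (6 * n div d) - int (3 * n div d) - int (2 * n div d) - int (n div d)))"
proof -
  have "ln (multinomial321 n) = ln (fact (6 * n)) - ln (fact (3 * n)) - ln (fact (2 * n)) - ln (fact n)"
    by (simp add: multinomial321_def ln_div ln_mult)
  also have "\<dots> = (\<Sum>d=1..6*n. mangoldt d * real (6 * n div d))
      - (\<Sum>d=1..6*n. mangoldt d * real (3 * n div d))
      - (\<Sum>d=1..6*n. mangoldt d * real (2 * n div d))
      - (\<Sum>d=1..6*n. mangoldt d * real (n div d))"
    by (intro arg_cong2[of _ _ _ _ minus] ln_fact_eq_sum_mangoldt) auto
  finally show ?thesis
    by (simp add: sum_subtractf [symmetric] algebra_simps)
qed

text \<open>The weights are at least 1 for \<open>n < d \<le> 6 n\<close> and nonnegative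
  elsewhere.\<close>

lemma psi_diff_le_ln_multinomial321: "psi (6 * n) - psi n \<le> ln (multinomial321 n)"
proof -
  let ?f = "\<lambda>d. int (6 * n div d) - int (3 * n div d) - int (2 * n div d) - int (n div d)"
  have "psi (6 * n) = psi n + (\<Sum>d\<in>{n<..6*n}. mangoldt d)"
    unfolding psi_def by (subst sum.union_disjoint [symmetric]) (auto intro!: sum.cong)
  also have "(\<Sum>d\<in>{n<..6*n}. mangoldt d) \<le> (\<Sum>d\<in>{n<..6*n}. mangoldt d * real_of_int (?f d))"
  proof (intro sum_mono)
    fix d assume "d \<in> {n<..6*n}"
    then have "1 \<le> ?f d" by (intro chebyshev_weights(3)) auto
    then have "1 \<le> real_of_int (?f d)" by linarith
    then show "mangoldt d \<le> mangoldt d * real_of_int (?f d)"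
      using mult_left_mono[OF _ mangoldt_nonneg] by fastforce
  qed
  also have "\<dots> \<le> (\<Sum>d=1..6*n. mangoldt d * real_of_int (?f d))"
  proof (intro sum_mono2)
    fix d assume "d \<in> {1..6*n} - {n<..6*n}"
    then have "0 \<le> ?f d" by (intro chebyshev_weights(1)) auto
    then show "0 \<le> mangoldt d * real_of_int (?f d)"
      by (intro mult_nonneg_nonneg mangoldt_nonneg) linarith
  qed auto
  finally show ?thesis unfolding ln_multinomial321_eq_sum_mangoldt by simp
qed

text \<open>The weights never exceed 2, and exceed 1 only for \<open>d \<le> 6 n / 5\<close>; the
  second \<open>psi\<close> pays for these \<open>d\<close>.\<close>

lemma ln_multinomial321_le_psi: "ln (multinomial321 n) \<le> psi (6 * n) + psi (6 * n div 5)"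
proof -
  let ?f = "\<lambda>d. int (6 * n div d) - int (3 * n div d) - int (2 * n div d) - int (n div d)"
  have "ln (multinomial321 n) \<le> (\<Sum>d=1..6*n. mangoldt d + (if d \<le> 6 * n div 5 then mangoldt d else 0))"
    unfolding ln_multinomial321_eq_sum_mangoldt
  proof (intro sum_mono)
    fix d assume d: "d \<in> {1..6*n}"
    have "?f d \<le> (if d \<le> 6 * n div 5 then 2 else 1)"
      using chebyshev_weights(2)[of d n] chebyshev_weights(4)[of d n] d by auto
    then have "real_of_int (?f d) \<le> (if d \<le> 6 * n div 5 then 2 else 1)"
      by (auto split: if_splits)
    then have "mangoldt d * real_of_int (?f d) \<le> mangoldt d * (if d \<le> 6 * n div 5 then 2 else 1)"
      by (intro mult_left_mono mangoldt_nonneg)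
    then show "mangoldt d * real_of_int (?f d) \<le> mangoldt d + (if d \<le> 6 * n div 5 then mangoldt d else 0)"
      by (auto split: if_splits)
  qed
  also have "\<dots> = psi (6 * n) + (\<Sum>d\<in>{d\<in>{1..6*n}. d \<le> 6 * n div 5}. mangoldt d)"
    by (simp only: psi_def sum.distrib sum.inter_filter finite_atLeastAtMost)
  also have "{d\<in>{1..6*n}. d \<le> 6 * n div 5} = {1..6 * n div 5}" by auto
  finally show ?thesis by (simp add: psi_def)
qed

text \<open>The slope must exceed \<open>ln 432 / 5\<close> for the induction, and \<open>1.08\<close> times the slope must stay
  below \<open>1.4 ln 432 / 6\<close> in the proof of \<open>prime_in_interval\<close>.\<close>

lemma psi_upper: "\<exists>B\<ge>0. \<forall>N. psi N \<le> 21/100 * ln 432 * real N + B"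
proof -
  define L :: real where "L = ln 432"
  have L: "L > 0" by (simp add: L_def)
  have step: "psi (6 * n) \<le> psi n + real n * L" for n
  proof -
    have "ln (multinomial321 n) \<le> ln (432 ^ n)"
      using multinomial321_le[of n] multinomial321_pos[of n] by simp
    then show ?thesis using psi_diff_le_ln_multinomial321[of n] by (simp add: ln_realpow L_def)
  qed
  \<comment> \<open>The induction step needs \<open>121 n \<le> 21 N\<close> with
    \<open>6 n \<le> N + 6\<close>, which holds from \<open>N = 146\<close> on; the cut-off 200
    leaves some room.\<close>
  define B where "B = psi 200"
  have "psi N \<le> 21/100 * L * real N + B" for N
  proof (induction N rule: less_induct)
    case (less N)
    show ?case
    proof (cases "N \<le> 200")
      case True
      then have "psi N \<le> B" unfolding B_def by (rule psi_mono)
      moreover have "0 \<le> 21/100 * L * real N" using L by simp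
      ultimately show ?thesis by linarith
    next
      case False
      define n where "n = N div 6 + 1"
      have n: "n < N" "N \<le> 6 * n" "6 * n \<le> N + 6" using False by (auto simp: n_def)
      have "psi N \<le> psi (6 * n)" by (rule psi_mono) fact
      also have "\<dots> \<le> psi n + real n * L" by (rule step)
      also have "\<dots> \<le> 21/100 * L * real n + B + real n * L"
        using less[OF n(1)] by linarith
      also have "\<dots> = L * (121/100 * real n) + B" by (simp add: algebra_simps)
      also have "\<dots> \<le> L * (21/100 * real N) + B"
        using n False L by (intro add_right_mono mult_left_mono) linarith+
      finally show ?thesis by (simp add: mult_ac)
    qed
  qed
  moreover have "B \<ge> 0" by (simp add: B_def psi_nonneg)
  ultimately show ?thesis unfolding L_def by blast
qed

section \<open>From psi to primes in intervals\<close>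

text \<open>A proper prime power \<open>p ^ j \<le> N\<close> has \<open>p \<le> sqrt N\<close>,
  because \<open>j \<ge> 2\<close>, and \<open>j \<le> log 2 N\<close>, because
  \<open>p \<ge> 2\<close>.\<close>

lemma primepow_not_prime_card:
  "card {d. d \<le> N \<and> primepow d \<and> \<not> prime d} \<le> (sqrt (real N) + 1) * (log 2 (real N) + 1)" if "N \<ge> 1"
proof -
  define a b where "a = nat \<lfloor>sqrt (real N)\<rfloor>" and "b = nat \<lfloor>log 2 (real N)\<rfloor>"
  have "{d. d \<le> N \<and> primepow d \<and> \<not> prime d} \<subseteq> (\<lambda>(p, j). p ^ j) ` ({..a} \<times> {..b})"
  proof safe
    fix d :: nat assume d: "d \<le> N" "primepow d" "\<not> prime d"
    then obtain p j where pj: "prime p" "j > 0" "d = p ^ j" by (auto simp: primepow_def)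
    have p: "p \<ge> 2" using pj(1) by (rule prime_ge_2_nat)
    have "j \<noteq> 1" using d pj by auto
    then have "p ^ 2 \<le> p ^ j" using pj p by (intro power_increasing) auto
    then have "p ^ 2 \<le> N" using d pj by simp
    then have "real p ^ 2 \<le> real N" by (metis of_nat_le_iff of_nat_power)
    then have "real p \<le> sqrt (real N)" by (rule real_le_rsqrt)
    then have pa: "p \<le> a" unfolding a_def by (simp add: le_nat_floor)
    have "2 ^ j \<le> p ^ j" using p by (rule power_mono) simp
    also have "\<dots> \<le> N" using d pj by simp
    finally have "2 ^ j \<le> N" .
    then have "2 ^ j \<le> real N" by (metis of_nat_le_iff of_nat_numeral of_nat_power)
    then have "real j \<le> log 2 (real N)" by (simp add: le_log_of_power)
    then have "j \<le> b" unfolding b_def by (simp add: le_nat_floor)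
    then show "d \<in> (\<lambda>(p, j). p ^ j) ` ({..a} \<times> {..b})" using pa pj by auto
  qed
  then have "card {d. d \<le> N \<and> primepow d \<and> \<not> prime d} \<le> card ({..a} \<times> {..b})"
    by (rule surj_card_le[rotated]) simp
  then have "real (card {d. d \<le> N \<and> primepow d \<and> \<not> prime d}) \<le> real (Suc a * Suc b)"
    by (simp add: card_cartesian_product flip: of_nat_Suc of_nat_mult del: mult_Suc mult_Suc_right)
  also have "real (Suc a * Suc b) = (real a + 1) * (real b + 1)" by (simp add: algebra_simps)
  also have "\<dots> \<le> (sqrt (real N) + 1) * (log 2 (real N) + 1)"
    using that by (intro mult_mono add_mono) (auto simp: a_def b_def)
  finally show ?thesis .
qed

text \<open>Only proper prime powers contribute on an interval without primes, each at most
  \<open>ln N\<close>, so \<open>psi\<close> gains far less than a linear amount there.\<close>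

lemma psi_diff_prime_free:
  assumes "M \<le> N" "N \<ge> 1" "\<And>p. prime p \<Longrightarrow> M < p \<Longrightarrow> p \<le> N \<Longrightarrow> False"
  shows "psi N - psi M \<le> (sqrt (real N) + 1) * (log 2 (real N) + 1) * ln (real N)"
proof -
  let ?A = "{d. d \<le> N \<and> primepow d \<and> \<not> prime d}"
  have "psi N = psi M + (\<Sum>d\<in>{M<..N}. mangoldt d)"
    unfolding psi_def using assms(1)
    by (subst sum.union_disjoint [symmetric]) (auto intro!: sum.cong)
  also have "(\<Sum>d\<in>{M<..N}. mangoldt d) \<le> (\<Sum>d\<in>{M<..N} \<inter> ?A. mangoldt d :: real)"
  proof (rule eq_refl, rule sum.mono_neutral_right, goal_cases)
    case 3
    show ?case
    proof
      fix d assume "d \<in> {M<..N} - {M<..N} \<inter> ?A"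
      then have "\<not> primepow d" using assms(3)[of d] by auto
      then show "mangoldt d = (0::real)" by (simp add: mangoldt_def)
    qed
  qed auto
  also have "\<dots> \<le> (\<Sum>d\<in>?A. mangoldt d)"
    by (intro sum_mono2) (auto simp: mangoldt_nonneg)
  also have "\<dots> \<le> (\<Sum>d\<in>?A. ln (real N))"
  proof (intro sum_mono)
    fix d assume "d \<in> ?A"
    then have "d > 0" "d \<le> N" by (auto simp: primepow_gt_0_nat)
    then show "mangoldt d \<le> ln (real N)"
      using mangoldt_le[of d] by (meson ln_mono of_nat_0_less_iff of_nat_le_iff order_trans)
  qed
  also have "\<dots> \<le> (sqrt (real N) + 1) * (log 2 (real N) + 1) * ln (real N)"
    using primepow_not_prime_card[OF assms(2)] assms(2) by (simp add: mult_right_mono)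
  finally show ?thesis by simp
qed

text \<open>Take \<open>6 n\<close> just below \<open>7/5 x\<close>. Without a prime in the
  interval, \<open>psi (6 n)\<close> is \<open>psi (4/5 x)\<close> up to lower order, and the upper
  bound on \<open>psi\<close> then contradicts the lower bound on
  \<open>psi (6 n) + psi (6 n div 5)\<close>.\<close>

lemma prime_in_interval:
  "eventually (\<lambda>x::real. \<exists>p. prime p \<and> 4/5 * x \<le> real p \<and> real p \<le> 7/5 * x) at_top"
proof -
  obtain B where B: "B \<ge> 0" "\<And>N. psi N \<le> 21/100 * ln 432 * real N + B"
    using psi_upper by blast
  define L :: real where "L = ln 432"
  have L: "L > 0" by (simp add: L_def)
  \<comment> \<open>The linear terms decide: \<open>7/30\<close> on the left against
    \<open>21/100 * 108/100 = 0.2268\<close> on the right, where \<open>108/100\<close> is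
    \<open>4/5 + 28/100\<close> and \<open>28/100\<close> comes from
    \<open>6 n div 5\<close>.\<close>
  have "eventually (\<lambda>x. (7/5 * x / 6 - 1) * L - ln (8 * (7/5 * x / 6)) >
      21/100 * L * (108/100 * x) + 2 * B +
      (sqrt (7/5 * x) + 1) * (log 2 (7/5 * x) + 1) * ln (7/5 * x)) at_top"
    using L by real_asymp
  then show ?thesis
    using eventually_ge_at_top[of 100]
  proof eventually_elim
    case (elim x)
    define n where "n = nat \<lfloor>7/5 * x / 6\<rfloor>"
    define M where "M = nat \<lfloor>4/5 * x\<rfloor>"
    have n: "real n \<le> 7/5 * x / 6" "real n > 7/5 * x / 6 - 1"
      unfolding n_def using elim(2) by linarith+
    have M: "real M \<le> 4/5 * x" "real M > 4/5 * x - 1"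
      unfolding M_def using elim(2) by linarith+
    have "real M \<le> real (6 * n)" using n M elim(2) by simp
    then have MN: "M \<le> 6 * n" by linarith
    have n1: "n \<ge> 1" using n elim(2) by simp
    show ?case
    proof (rule ccontr)
      assume no: "\<not> ?thesis"
      have "psi (6 * n) - psi M \<le> (sqrt (real (6 * n)) + 1) * (log 2 (real (6 * n)) + 1) * ln (real (6 * n))"
      proof (rule psi_diff_prime_free)
        fix p assume p: "prime p" "M < p" "p \<le> 6 * n"
        have "4/5 * x \<le> real p" using p(2) M_def by linarith
        moreover have "real p \<le> 7/5 * x" using p(3) n by linarith
        ultimately show False using no p(1) by blast
      qed (use MN n1 in auto)
      also have "\<dots> \<le> (sqrt (7/5 * x) + 1) * (log 2 (7/5 * x) + 1) * ln (7/5 * x)"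
        using n n1 by (intro mult_mono add_mono) (auto intro!: mult_nonneg_nonneg add_nonneg_nonneg)
      finally have 1: "psi (6 * n) \<le> psi M + (sqrt (7/5 * x) + 1) * (log 2 (7/5 * x) + 1) * ln (7/5 * x)"
        by simp
      have "432 ^ n / (8 * real n) \<le> multinomial321 n"
        using multinomial321_ge[OF n1] n1 by (simp add: field_simps)
      then have "ln (432 ^ n / (8 * real n)) \<le> ln (multinomial321 n)"
        using n1 by (intro ln_mono) auto
      then have "real n * L - ln (8 * real n) \<le> ln (multinomial321 n)"
        using n1 by (simp add: ln_div ln_realpow L_def)
      also have "\<dots> \<le> psi (6 * n) + psi (6 * n div 5)" by (rule ln_multinomial321_le_psi)
      finally have 2: "real n * L - ln (8 * real n) \<le> psi (6 * n) + psi (6 * n div 5)" .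
      have "(7/5 * x / 6 - 1) * L \<le> real n * L"
        using n L by (intro mult_right_mono) auto
      moreover have "ln (8 * real n) \<le> ln (8 * (7/5 * x / 6))"
        using n n1 by (intro ln_mono) auto
      moreover have "psi M \<le> 21/100 * L * (4/5 * x) + B"
        using B(2)[of M] mult_left_mono[OF M(1), of "21/100 * L"] L unfolding L_def by linarith
      moreover have "psi (6 * n div 5) \<le> 21/100 * L * (28/100 * x) + B"
      proof -
        have "real (6 * n div 5) \<le> 28/100 * x" using n by linarith
        then have "21/100 * L * real (6 * n div 5) \<le> 21/100 * L * (28/100 * x)"
          using L by (intro mult_left_mono) auto
        then show ?thesis using B(2)[of "6 * n div 5"] unfolding L_def by linarith
      qed
      ultimately have "(7/5 * x / 6 - 1) * L - ln (8 * (7/5 * x / 6)) \<le>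
        21/100 * L * (4/5 * x) + 21/100 * L * (28/100 * x) + 2 * B +
        (sqrt (7/5 * x) + 1) * (log 2 (7/5 * x) + 1) * ln (7/5 * x)"
        using 1 2 by linarith
      then show False using elim(1) by (simp add: algebra_simps)
    qed
  qed
qed

section \<open>Counting paths\<close>

lemma simple_graph_finite: "simple_graph n E \<Longrightarrow> finite E"
  by (rule finite_subset[of _ "Pow {..<n}"]) (auto simp: simple_graph_def)

lemma finite_path_copies: "finite E \<Longrightarrow> finite (path_copies E l)"
  by (rule finite_subset[of _ "Pow E"]) (auto simp: path_copies_def)

lemma card_path_copies_le_ex:
  assumes "simple_graph n E" "\<not> has_cycle E m"
  shows "card (path_copies E l) \<le> ex_path_cycle n l m"
proof -
  have "finite {E. simple_graph n E \<and> \<not> has_cycle E m}"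
    by (rule finite_subset[of _ "Pow (Pow {..<n})"]) (auto simp: simple_graph_def)
  then have "finite {card (path_copies E l) | E. simple_graph n E \<and> \<not> has_cycle E m}"
    by simp
  then show ?thesis
    unfolding ex_path_cycle_def using assms by (intro Max_ge) auto
qed

text \<open>Unrolls the cycle to a periodic sequence on all naturals, so that neighbours of a
  position need no reduction of indices.\<close>

lemma has_cycleE:
  assumes "has_cycle E m" "m > 0"
  obtains w :: "nat \<Rightarrow> nat" where "\<And>i. {w i, w (Suc i)} \<in> E" "\<And>i j. w i = w j \<longleftrightarrow> i mod m = j mod m"
proof -
  obtain v :: "nat \<Rightarrow> nat" where v: "inj_on v {..<m}" "\<And>i. i < m \<Longrightarrow> {v i, v (Suc i mod m)} \<in> E"
    using assms(1) unfolding has_cycle_def by blast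
  show ?thesis
  proof (rule that[of "\<lambda>i. v (i mod m)"])
    show "{v (i mod m), v (Suc i mod m)} \<in> E" for i
      using v(2)[of "i mod m"] assms(2) by (simp add: mod_Suc_eq)
    show "v (i mod m) = v (j mod m) \<longleftrightarrow> i mod m = j mod m" for i j
      using inj_on_eq_iff[OF v(1)] assms(2) by simp
  qed
qed

section \<open>Paths as vertex lists, determined by their edges up to reversal\<close>

definition edges_of :: "'a list \<Rightarrow> 'a set set" where
  "edges_of xs = {{xs ! i, xs ! Suc i} | i. Suc i < length xs}"

lemma edges_of_rev: "edges_of (rev xs) = edges_of xs"
proof -
  have "edges_of (rev xs) \<subseteq> edges_of xs" for xs :: "'a list"
  proof
    fix e assume "e \<in> edges_of (rev xs)"
    then obtain i where i: "Suc i < length xs" "e = {rev xs ! i, rev xs ! Suc i}"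
      by (auto simp: edges_of_def)
    define j where "j = length xs - Suc (Suc i)"
    have "rev xs ! i = xs ! Suc j" "rev xs ! Suc i = xs ! j" "Suc j < length xs"
      using i by (auto simp: rev_nth j_def Suc_diff_Suc)
    then show "e \<in> edges_of xs" using i by (auto simp: edges_of_def)
  qed
  from this[of xs] this[of "rev xs"] show ?thesis by auto
qed

lemma edges_of_hd_neighbour:
  assumes "distinct xs" "{hd xs, y} \<in> edges_of xs" "length xs \<ge> 2"
  shows "y = xs ! 1"
proof -
  from assms(2) obtain i where i: "Suc i < length xs" "{hd xs, y} = {xs ! i, xs ! Suc i}"
    by (auto simp: edges_of_def)
  have h: "hd xs = xs ! 0" using assms(3) by (intro hd_conv_nth) force
  then have "xs ! 0 = xs ! i \<or> xs ! 0 = xs ! Suc i" using i by (metis doubleton_eq_iff)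
  moreover have "0 < length xs" using assms(3) by linarith
  ultimately have "i = 0" using i assms(1) by (metis Suc_lessD nat.distinct(1) nth_eq_iff_index_eq)
  then show ?thesis using i h assms
    by (metis One_nat_def doubleton_eq_iff)
qed

text \<open>From a common end the edge set forces each next vertex: the only other edge at the
  current vertex leads back to a vertex already visited.\<close>

lemma edges_of_inj_same_hd:
  assumes "distinct xs" "distinct ys" "length xs = length ys" "edges_of xs = edges_of ys"
    "length xs \<ge> 2" "hd xs = hd ys"
  shows "xs = ys"
proof (rule nth_equalityI)
  fix i assume "i < length xs"
  then show "xs ! i = ys ! i"
  proof (induction i rule: less_induct)
    case (less i)
    consider "i = 0" | j where "i = Suc j" by (cases i) auto
    then show ?case
    proof cases
      case 1
      then show ?thesis using assms(3,5,6) by (cases xs; cases ys) auto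
    next
      case (2 j)
      have xy: "xs ! j = ys ! j" using less 2 by auto
      have "{xs ! j, xs ! Suc j} \<in> edges_of ys"
        using less.prems 2 assms(4) by (auto simp: edges_of_def)
      then obtain t where t: "Suc t < length ys" "{xs ! j, xs ! Suc j} = {ys ! t, ys ! Suc t}"
        by (auto simp: edges_of_def)
      show ?thesis
      proof (cases "j = t")
        case True
        then show ?thesis using t(2) xy 2 by (metis doubleton_eq_iff)
      next
        \<comment> \<open>Here \<open>ys\<close> traverses the edge in the opposite direction, so
          \<open>xs\<close> would return to its vertex at position \<open>j - 1\<close>.\<close>
        case False
        have jl: "j < length ys" using less.prems 2 assms(3) by simp
        then have "ys ! j \<noteq> ys ! t" using False t assms(2) nth_eq_iff_index_eq by (metis Suc_lessD)
        then have a: "ys ! j = ys ! Suc t" "xs ! Suc j = ys ! t"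
          using t(2) xy by (metis doubleton_eq_iff)+
        then have "j = Suc t" using t(1) jl assms(2) nth_eq_iff_index_eq by metis
        moreover from this have "xs ! t = ys ! t" using less 2 by auto
        ultimately have "xs ! Suc j = xs ! t" using a by simp
        then have "Suc j = t" using less.prems 2 \<open>j = Suc t\<close> assms(1) nth_eq_iff_index_eq
          by (metis Suc_lessD)
        then show ?thesis using \<open>j = Suc t\<close> by simp
      qed
    qed
  qed
qed (use assms in auto)

text \<open>The head of \<open>ys\<close> has a single neighbour in the path, whereas an inner
  vertex of \<open>xs\<close> has two. So \<open>ys\<close> starts at the first or the last vertex
  of \<open>xs\<close>.\<close>

lemma edges_of_eq_imp:
  assumes "distinct xs" "distinct ys" "length xs = length ys" "edges_of xs = edges_of ys" "length xs \<ge> 2"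
  shows "ys = xs \<or> ys = rev xs"
proof -
  have yl: "length ys \<ge> 2" using assms by simp
  have "{ys ! 0, ys ! 1} \<in> edges_of ys" using yl by (auto simp: edges_of_def)
  then have "{ys ! 0, ys ! 1} \<in> edges_of xs" using assms by simp
  then have "ys ! 0 \<in> set xs" by (auto simp: edges_of_def doubleton_eq_iff)
  moreover have "hd ys = ys ! 0" using yl by (intro hd_conv_nth) force
  ultimately obtain i where i: "i < length xs" "hd ys = xs ! i" by (metis in_set_conv_nth)
  consider "i = 0" | "Suc i = length xs" | j where "i = Suc j" "Suc i < length xs"
    using i(1) by (metis Suc_lessI not0_implies_Suc)
  then show ?thesis
  proof cases
    case 1
    then have "hd xs = hd ys" using i by (cases xs) auto
    then show ?thesis using edges_of_inj_same_hd assms by blast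
  next
    case 2
    then have "hd (rev xs) = hd ys" using i by (metis diff_Suc_1 hd_rev last_conv_nth length_0_conv nat.distinct(1))
    then have "rev xs = ys" using edges_of_inj_same_hd[of "rev xs" ys] assms by (simp add: edges_of_rev)
    then show ?thesis by simp
  next
    case (3 j)
    have "{xs ! j, xs ! Suc j} \<in> edges_of xs" "{xs ! i, xs ! Suc i} \<in> edges_of xs"
      using 3 by (auto simp: edges_of_def)
    then have "{xs ! j, xs ! Suc j} \<in> edges_of ys" "{xs ! i, xs ! Suc i} \<in> edges_of ys"
      using assms(4) by simp_all
    then have "{hd ys, xs ! j} \<in> edges_of ys" "{hd ys, xs ! Suc i} \<in> edges_of ys"
      using 3 i by (simp_all add: insert_commute)
    then have "xs ! j = xs ! Suc i" using edges_of_hd_neighbour[OF assms(2) _ yl] by metis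
    then have "j = Suc i" using 3 assms(1) nth_eq_iff_index_eq by (metis Suc_lessD)
    then show ?thesis using 3 by simp
  qed
qed

text \<open>Each fibre of \<open>edges_of\<close> on \<open>F\<close> contains at most a list and
  its reversal.\<close>

lemma card_paths_le:
  assumes "finite E" "l \<ge> 2"
    and F: "\<And>xs. xs \<in> F \<Longrightarrow> distinct xs \<and> length xs = l \<and> edges_of xs \<subseteq> E"
  shows "card F \<le> 2 * card (path_copies E l)"
proof -
  have sub: "edges_of ` F \<subseteq> path_copies E l"
  proof safe
    fix xs assume xs: "xs \<in> F"
    note F = F[OF xs]
    have "inj_on ((!) xs) {..<l}" using F by (simp add: inj_on_nth)
    moreover have "{xs ! i, xs ! Suc i} \<in> E" if "Suc i < l" for i
      using F that by (auto simp: edges_of_def)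
    moreover have "edges_of xs = {{xs ! i, xs ! Suc i} | i. Suc i < l}"
      using F by (simp add: edges_of_def)
    ultimately show "edges_of xs \<in> path_copies E l"
      unfolding path_copies_def by blast
  qed
  have fib: "card {xs \<in> F. edges_of xs = e} \<le> 2" for e
  proof (cases "{xs \<in> F. edges_of xs = e} = {}")
    case False
    then obtain xs where xs: "xs \<in> F" "edges_of xs = e" by auto
    have "{xs \<in> F. edges_of xs = e} \<subseteq> {xs, rev xs}"
      using edges_of_eq_imp[of xs] F xs assms(2) by auto
    then have "card {xs \<in> F. edges_of xs = e} \<le> card {xs, rev xs}" by (intro card_mono) auto
    also have "\<dots> \<le> 2" by (simp add: card_insert_if)
    finally show ?thesis .
  qed (simp only: card.empty)
  have fin: "finite (edges_of ` F)" using sub finite_path_copies[OF assms(1)] finite_subset by blast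
  have "F = (\<Union>e\<in>edges_of ` F. {xs \<in> F. edges_of xs = e})" by auto
  then have "card F \<le> (\<Sum>e\<in>edges_of ` F. card {xs \<in> F. edges_of xs = e})"
    using card_UN_le[OF fin] by metis
  also have "\<dots> \<le> (\<Sum>e\<in>edges_of ` F. 2)" by (intro sum_mono fib)
  also have "\<dots> \<le> 2 * card (path_copies E l)"
    using card_mono[OF finite_path_copies[OF assms(1)] sub] by simp
  finally show ?thesis .
qed

section \<open>Greedy enumeration of paths\<close>

fun grow :: "('a list \<Rightarrow> 'a set) \<Rightarrow> nat \<Rightarrow> 'a list set" where
  "grow C 0 = {[]}"
| "grow C (Suc i) = (\<lambda>(xs, y). xs @ [y]) ` (SIGMA xs:grow C i. C xs)"

lemma length_grow: "xs \<in> grow C i \<Longrightarrow> length xs = i"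
  by (induction i arbitrary: xs) auto

lemma nth_grow: "xs \<in> grow C i \<Longrightarrow> j < i \<Longrightarrow> xs ! j \<in> C (take j xs)"
proof (induction i arbitrary: xs)
  case (Suc i)
  then obtain ys y where "xs = ys @ [y]" "ys \<in> grow C i" "y \<in> C ys" by auto
  then show ?case using Suc length_grow[of ys C i] by (cases "j = i") (auto simp: nth_append)
qed simp

lemma card_grow:
  assumes "\<And>i xs. i < l \<Longrightarrow> xs \<in> grow C i \<Longrightarrow> finite (C xs) \<and> a i \<le> card (C xs)"
  shows "finite (grow C l) \<and> (\<Prod>i<l. a i) \<le> card (grow C l)"
  using assms
proof (induction l)
  case (Suc l)
  have "finite (grow C l) \<and> (\<Prod>i<l. a i) \<le> card (grow C l)"
    by (rule Suc.IH) (use Suc.prems less_SucI in blast)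
  then have IH: "finite (grow C l)" "(\<Prod>i<l. a i) \<le> card (grow C l)" by auto
  have "(\<Prod>i<Suc l. a i) \<le> card (grow C l) * a l" using IH by simp
  also have "\<dots> = (\<Sum>xs\<in>grow C l. a l)" by simp
  also have "\<dots> \<le> (\<Sum>xs\<in>grow C l. card (C xs))" using Suc.prems by (intro sum_mono) auto
  also have "\<dots> = card (SIGMA xs:grow C l. C xs)"
    using IH Suc.prems by (intro card_SigmaI [symmetric]) auto
  also have "\<dots> = card (grow C (Suc l))"
    by (simp add: card_image inj_on_def split_beta prod_eq_iff)
  finally show ?case using IH Suc.prems by (auto intro!: finite_SigmaI)
qed simp

text \<open>Reduces each construction to a choice of \<open>C\<close>: extensions must be new
  neighbours of the last vertex, and \<open>a i\<close> bounds the number of choices at position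
  \<open>i\<close> from below.\<close>

lemma prod_le_card_path_copies:
  assumes "finite E" "l \<ge> 2"
    and "\<And>i xs. i < l \<Longrightarrow> xs \<in> grow C i \<Longrightarrow> finite (C xs) \<and> a i \<le> card (C xs)"
    and "\<And>i xs y. Suc i < l \<Longrightarrow> xs \<in> grow C (Suc i) \<Longrightarrow> y \<in> C xs \<Longrightarrow> y \<notin> set xs \<and> {xs ! i, y} \<in> E"
  shows "(\<Prod>i<l. a i) \<le> 2 * card (path_copies E l)"
proof -
  have "distinct xs \<and> edges_of xs \<subseteq> E" if "xs \<in> grow C i" "i \<le> l" for i xs
    using that
  proof (induction i arbitrary: xs)
    case 0
    then show ?case by (simp add: edges_of_def)
  next
    case (Suc i)
    then obtain ys y where ys: "xs = ys @ [y]" "ys \<in> grow C i" "y \<in> C ys" by auto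
    have IH: "distinct ys" "edges_of ys \<subseteq> E" using Suc ys by auto
    have len: "length ys = i" using ys length_grow by blast
    show ?case
    proof (cases i)
      case 0
      then show ?thesis using ys len by (simp add: edges_of_def)
    next
      case (Suc j)
      have y: "y \<notin> set ys" "{ys ! j, y} \<in> E" using assms(4)[of j ys y] ys Suc Suc.prems by auto
      have "edges_of xs \<subseteq> insert {ys ! j, y} (edges_of ys)"
        using len Suc unfolding ys(1) edges_of_def by (auto simp: nth_append less_Suc_eq)
      then show ?thesis using y IH ys by auto
    qed
  qed
  then have "card (grow C l) \<le> 2 * card (path_copies E l)"
    using assms(1,2) by (intro card_paths_le) (auto dest: length_grow)
  then show ?thesis using card_grow[of l C a] assms(3) by force
qed

text \<open>Positions start at 0, so among \<open>l\<close> of them \<open>l div 2\<close> are odd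
  and \<open>(l + 1) div 2\<close> are even. The even positions will supply the power of
  \<open>n\<close>.\<close>

lemma prod_parity:
  fixes f :: "nat \<Rightarrow> 'a :: comm_monoid_mult"
  shows "(\<Prod>i<l. if odd i then f (i div 2) else c) = (\<Prod>j<l div 2. f j) * c ^ ((l + 1) div 2)"
proof (induction l)
  case (Suc l)
  show ?case
  proof (cases "odd l")
    case True
    then have "Suc l div 2 = Suc (l div 2)" "(Suc l + 1) div 2 = (l + 1) div 2" by presburger+
    then show ?thesis using Suc True by (simp add: mult_ac)
  next
    case False
    then have "Suc l div 2 = l div 2" "(Suc l + 1) div 2 = Suc ((l + 1) div 2)" by presburger+
    then show ?thesis using Suc False by (simp add: mult_ac)
  qed
qed simp

section \<open>The extremal graphs\<close>

definition complete_bipartite :: "nat \<Rightarrow> nat \<Rightarrow> nat set set" where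
  "complete_bipartite r n = {{a, b} | a b. a < r \<and> r \<le> b \<and> b < n}"

lemma complete_bipartite_iff:
  "{x, y} \<in> complete_bipartite r n \<longleftrightarrow> x < r \<and> r \<le> y \<and> y < n \<or> y < r \<and> r \<le> x \<and> x < n"
  by (auto simp: complete_bipartite_def doubleton_eq_iff)

lemma simple_complete_bipartite: "simple_graph n (complete_bipartite r n)"
  by (auto simp: simple_graph_def complete_bipartite_def card_insert_if)

text \<open>The cycle alternates between the parts and would need \<open>k\<close> distinct vertices
  in the part of size \<open>r\<close>.\<close>

lemma complete_bipartite_no_cycle:
  assumes "r < k"
  shows "\<not> has_cycle (complete_bipartite r n) (2 * k)"
proof
  assume "has_cycle (complete_bipartite r n) (2 * k)"
  then obtain w :: "nat \<Rightarrow> nat" where w: "\<And>i. {w i, w (Suc i)} \<in> complete_bipartite r n"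
     "\<And>i j. w i = w j \<longleftrightarrow> i mod (2 * k) = j mod (2 * k)"
    using assms by (elim has_cycleE) auto
  \<comment> \<open>The parity of the positions that lie in the small part.\<close>
  define b :: nat where "b = (if w 0 < r then 0 else 1)"
  have alt: "w (Suc i) < r \<longleftrightarrow> \<not> w i < r" for i
    using w(1)[of i] by (auto simp: complete_bipartite_iff)
  have small: "w (b + 2 * j) < r" for j
  proof (induction j)
    case 0
    then show ?case using alt[of 0] by (simp add: b_def)
  next
    case (Suc j)
    then show ?case using alt[of "b + 2 * j"] alt[of "Suc (b + 2 * j)"] by simp
  qed
  have "inj_on (\<lambda>j. w (b + 2 * j)) {..<k}"
    by (auto simp: inj_on_def w(2) b_def split: if_splits)
  moreover have "(\<lambda>j. w (b + 2 * j)) ` {..<k} \<subseteq> {..<r}" using small by auto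
  ultimately have "card {..<k} \<le> card {..<r}" by (metis card_inj_on_le finite_lessThan)
  then show False using assms by simp
qed

text \<open>Paths start in the large part. The small part is too small for a crude count: at an odd
  position \<open>i\<close> exactly the earlier odd positions have used it, which leaves
  \<open>r - i div 2\<close> choices.\<close>

lemma complete_bipartite_paths:
  assumes "l \<ge> 2"
  shows "(\<Prod>j<l div 2. r - j) * (n - r - l) ^ ((l + 1) div 2)
     \<le> 2 * card (path_copies (complete_bipartite r n) l)"
proof -
  let ?S = "\<lambda>i. if odd i then {..<r} else {r..<n}"
  define C where "C = (\<lambda>xs :: nat list. ?S (length xs) - set xs)"
  have nth: "xs ! j \<in> ?S j" if "xs \<in> grow C i" "j < i" for xs i j
    using nth_grow[OF that] that length_grow[OF that(1)] unfolding C_def by simp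
  have "(\<Prod>i<l. if odd i then r - i div 2 else n - r - l) \<le> 2 * card (path_copies (complete_bipartite r n) l)"
  proof (rule prod_le_card_path_copies[where C = C])
    show "finite (complete_bipartite r n)"
      using simple_complete_bipartite by (rule simple_graph_finite)
    fix i xs assume i: "i < l" and xs: "xs \<in> grow C i"
    have len: "length xs = i" using xs by (rule length_grow)
    have "(if odd i then r - i div 2 else n - r - l) \<le> card (C xs)"
    proof (cases "odd i")
      case True
      have "set xs \<inter> {..<r} \<subseteq> (\<lambda>t. xs ! (2 * t + 1)) ` {..<i div 2}"
      proof
        fix x assume x: "x \<in> set xs \<inter> {..<r}"
        then obtain j where j: "j < i" "x = xs ! j" using len by (auto simp: in_set_conv_nth)
        then have "odd j" using nth[OF xs j(1)] x by (auto split: if_splits)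
        then obtain t where t: "j = 2 * t + 1" by (elim oddE)
        then have "t < i div 2" using j True by presburger
        then show "x \<in> (\<lambda>t. xs ! (2 * t + 1)) ` {..<i div 2}" using j t by auto
      qed
      then have "card (set xs \<inter> {..<r}) \<le> card {..<i div 2}" by (rule surj_card_le[rotated]) simp
      moreover have "C xs = {..<r} - (set xs \<inter> {..<r})" using True len by (auto simp: C_def)
      then have "card (C xs) = r - card (set xs \<inter> {..<r})" by (simp add: card_Diff_subset)
      ultimately show ?thesis using True by simp
    next
      case False
      have "card {r..<n} - card (set xs) \<le> card (C xs)"
        using False len diff_card_le_card_Diff[of "set xs" "{r..<n}"] by (simp add: C_def)
      moreover have "card (set xs) \<le> l" using card_length[of xs] len i by simp
      ultimately show ?thesis using False by simp
    qed
    then show "finite (C xs) \<and> (if odd i then r - i div 2 else n - r - l) \<le> card (C xs)"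
      by (simp add: C_def)
  next
    fix i xs y assume i: "Suc i < l" and xs: "xs \<in> grow C (Suc i)" and y: "y \<in> C xs"
    have len: "length xs = Suc i" using xs by (rule length_grow)
    show "y \<notin> set xs \<and> {xs ! i, y} \<in> complete_bipartite r n"
      using nth[OF xs, of i] y len unfolding C_def complete_bipartite_iff
      by (auto split: if_splits)
  qed fact
  then show ?thesis unfolding prod_parity by simp
qed

text \<open>The vertices \<open>0, \<dots>, m - 1\<close> are hubs; every other vertex is joined to two consecutive hubs.
  Thus the graph arises from a path with \<open>m\<close> vertices by replacing each edge by many paths of
  length two, and all its cycles have length four.\<close>

definition hub_path :: "nat \<Rightarrow> nat \<Rightarrow> nat set set" where
  "hub_path m n = {{h, v} | h v. h < m \<and> m \<le> v \<and> v < n \<and> (h = v mod (m - 1) \<or> h = Suc (v mod (m - 1)))}"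

lemma hub_path_iff:
  "{x, y} \<in> hub_path m n \<longleftrightarrow>
     x < m \<and> m \<le> y \<and> y < n \<and> (x = y mod (m - 1) \<or> x = Suc (y mod (m - 1))) \<or>
     y < m \<and> m \<le> x \<and> x < n \<and> (y = x mod (m - 1) \<or> y = Suc (x mod (m - 1)))"
  unfolding hub_path_def by (auto simp: doubleton_eq_iff)

lemma simple_hub_path: "simple_graph n (hub_path m n)"
  by (auto simp: simple_graph_def hub_path_def card_insert_if)

text \<open>Let \<open>h\<close> be the least vertex of the cycle; it is a hub. The hubs two steps
  before and two steps after it are larger, so both equal \<open>Suc h\<close>. These positions
  differ by 4, which is impossible on a cycle of length at least 6.\<close>

lemma hub_path_no_cycle:
  assumes "k \<ge> 3"
  shows "\<not> has_cycle (hub_path m n) (2 * k)"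
proof
  assume "has_cycle (hub_path m n) (2 * k)"
  then obtain w :: "nat \<Rightarrow> nat" where w: "\<And>i. {w i, w (Suc i)} \<in> hub_path m n"
     "\<And>i j. w i = w j \<longleftrightarrow> i mod (2 * k) = j mod (2 * k)"
    using assms by (elim has_cycleE) auto
  define h where "h = (LEAST h. h \<in> range w)"
  have "h \<in> range w" unfolding h_def by (rule LeastI[of _ "w 0"]) simp
  then obtain i0 where i0: "w i0 = h" by auto
  have h_le: "h \<le> w i" for i unfolding h_def by (rule Least_le) simp
  \<comment> \<open>Two positions before \<open>i0\<close>, shifted by a full period so that the
    subtraction is not truncated.\<close>
  define i where "i = i0 + 2 * k - 2"
  have "i + 2 = i0 + 2 * k" using assms by (simp add: i_def)
  then have i: "w (i + 2) = h" using i0 w(2)[of "i + 2" i0] by simp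
  have ne: "w j \<noteq> w (j + 2)" "w j \<noteq> w (j + 4)" for j
  proof -
    have "\<not> 2 * k dvd 2" "\<not> 2 * k dvd 4" using assms by (auto dest!: dvd_imp_le)
    then show "w j \<noteq> w (j + 2)" "w j \<noteq> w (j + 4)"
      unfolding w(2) using mod_eq_dvd_iff_nat[of j "j + 2" "2 * k"] mod_eq_dvd_iff_nat[of j "j + 4" "2 * k"]
      by (auto simp: eq_commute)
  qed
  have hub: "h < m" using w(1)[of "i + 2"] h_le[of "i + 3"] i by (auto simp: hub_path_iff numeral_eq_Suc)
  have next_hub: "y = Suc h" if "{h, v} \<in> hub_path m n" "{v, y} \<in> hub_path m n" "h \<le> y" "y \<noteq> h" for v y
    using that hub by (auto simp: hub_path_iff)
  have "w (i + 4) = Suc h"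
    using w(1)[of "i + 2"] w(1)[of "i + 3"] h_le ne(1)[of "i + 2"] i
    by (intro next_hub[of "w (i + 3)"]) (auto simp: numeral_eq_Suc)
  moreover have "w i = Suc h"
    using w(1)[of i] w(1)[of "i + 1"] h_le ne(1)[of i] i
    by (intro next_hub[of "w (i + 1)"]) (auto simp: numeral_eq_Suc insert_commute)
  ultimately show False using ne(2)[of i] by simp
qed

text \<open>Odd positions run through the hubs in increasing order and leave no choice. Each even
  position ranges over a residue class modulo \<open>m - 1\<close>, of which fewer than
  \<open>l\<close> vertices are already used.\<close>

lemma hub_path_paths:
  assumes "m \<ge> 3" "l \<ge> 2" "l \<le> 2 * m + 1"
  shows "((n - m) div (m - 1) - l) ^ ((l + 1) div 2) \<le> 2 * card (path_copies (hub_path m n) l)"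
proof -
  \<comment> \<open>Class \<open>t - 1\<close> joins hubs \<open>t - 1\<close> and \<open>t\<close>.
    Truncated subtraction yields class 0 before the first hub, and \<open>min\<close> yields class
    \<open>m - 2\<close> after the last one.\<close>
  define c where "c = (\<lambda>i :: nat. min (i div 2 - 1) (m - 2))"
  let ?S = "\<lambda>i. if odd i then {i div 2} else {v. m \<le> v \<and> v < n \<and> v mod (m - 1) = c i}"
  define C where "C = (\<lambda>xs :: nat list. ?S (length xs) - set xs)"
  have nth: "xs ! j \<in> ?S j" if "xs \<in> grow C i" "j < i" for xs i j
  proof -
    have "length (take j xs) = j" using that length_grow[OF that(1)] by simp
    then show ?thesis using nth_grow[OF that] unfolding C_def by (simp only: Diff_iff)
  qed
  have "(\<Prod>i<l. if odd i then 1 else (n - m) div (m - 1) - l) \<le> 2 * card (path_copies (hub_path m n) l)"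
  proof (rule prod_le_card_path_copies[where C = C])
    show "finite (hub_path m n)"
      using simple_hub_path by (rule simple_graph_finite)
    fix i xs assume i: "i < l" and xs: "xs \<in> grow C i"
    have len: "length xs = i" using xs by (rule length_grow)
    have "(if odd i then 1 else (n - m) div (m - 1) - l) \<le> card (C xs)"
    proof (cases "odd i")
      case True
      have "i div 2 \<notin> set xs"
      proof
        assume "i div 2 \<in> set xs"
        then obtain j where j: "j < i" "i div 2 = xs ! j" using len by (auto simp: in_set_conv_nth)
        have "i div 2 < m" using True i assms by presburger
        then have "odd j" "i div 2 = j div 2" using nth[OF xs j(1)] j(2) by (auto split: if_splits)
        then show False using True j(1) by presburger
      qed
      then have "C xs = {i div 2}" using True len by (auto simp: C_def)
      then show ?thesis using True by simp
    next
      case False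
      define N where "N = (n - m) div (m - 1)"
      \<comment> \<open>The offset from \<open>m\<close> to the first non-hub in class
        \<open>c i\<close>; adding \<open>m - 1\<close> before subtracting avoids
        truncation.\<close>
      define d where "d = (c i + (m - 1) - m mod (m - 1)) mod (m - 1)"
      have "(m + d) mod (m - 1) = c i"
      proof -
        have "(m + d) mod (m - 1) = (m mod (m - 1) + (c i + (m - 1) - m mod (m - 1))) mod (m - 1)"
          unfolding d_def by (simp add: mod_simps)
        also have "m mod (m - 1) + (c i + (m - 1) - m mod (m - 1)) = c i + (m - 1)"
          using mod_less_divisor[of "m - 1" m] assms by linarith
        also have "(c i + (m - 1)) mod (m - 1) = c i"
        proof -
          have "c i < m - 1" using assms by (auto simp: c_def)
          then show ?thesis by (simp only: mod_add_self2 mod_less)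
        qed
        finally show ?thesis .
      qed
      then have res: "(m + d + (m - 1) * t) mod (m - 1) = c i" for t by simp
      have "d < m - 1" using assms by (simp add: d_def)
      have "(\<lambda>t. m + d + (m - 1) * t) ` {..<N} \<subseteq> ?S i"
      proof safe
        fix t assume t: "t < N"
        have "(m - 1) * Suc t \<le> (m - 1) * N" using t by (intro mult_left_mono) auto
        also have "\<dots> \<le> n - m" by (simp add: N_def)
        finally have "m + d + (m - 1) * t < n" using \<open>d < m - 1\<close> by simp
        then show "m + d + (m - 1) * t \<in> ?S i" using False res by simp
      qed
      moreover have "inj_on (\<lambda>t. m + d + (m - 1) * t) {..<N}" using assms by (auto simp: inj_on_def)
      moreover have "finite (?S i)" by simp
      ultimately have "card {..<N} \<le> card (?S i)" by (intro card_inj_on_le)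
      then have "N \<le> card (?S i)" by (simp only: card_lessThan)
      moreover have "card (?S i) - card (set xs) \<le> card (C xs)"
      proof -
        have "C xs = ?S i - set xs" by (simp only: C_def len)
        then show ?thesis using diff_card_le_card_Diff[of "set xs" "?S i"] by (simp only: finite_set)
      qed
      moreover have "card (set xs) \<le> l" using card_length[of xs] len i by simp
      ultimately show ?thesis using False unfolding N_def by simp
    qed
    then show "finite (C xs) \<and> (if odd i then 1 else (n - m) div (m - 1) - l) \<le> card (C xs)"
      by (simp add: C_def)
  next
    fix i xs y assume i: "Suc i < l" and xs: "xs \<in> grow C (Suc i)" and y: "y \<in> C xs"
    have len: "length xs = Suc i" using xs by (rule length_grow)
    have x: "xs ! i \<in> ?S i" using nth[OF xs] by blast
    have y': "y \<in> ?S (Suc i)" "y \<notin> set xs" using y len by (auto simp: C_def)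
    have "{xs ! i, y} \<in> hub_path m n"
    proof (cases "odd i")
      case True
      then obtain t where t: "i = 2 * t + 1" by (elim oddE)
      have "xs ! i = t" "m \<le> y" "y < n" "y mod (m - 1) = min t (m - 2)" "t < m"
        using x y' t i assms by (auto simp: c_def)
      then show ?thesis unfolding hub_path_iff by (auto simp: min_def)
    next
      case False
      then obtain t where t: "i = 2 * t" using evenE by blast
      have "y = t" "m \<le> xs ! i" "xs ! i < n" "xs ! i mod (m - 1) = min (t - 1) (m - 2)" "t < m"
        using x y' t i assms by (auto simp: c_def)
      then show ?thesis unfolding hub_path_iff by (auto simp: min_def)
    qed
    then show "y \<notin> set xs \<and> {xs ! i, y} \<in> hub_path m n" using y' by simp
  qed fact
  then show ?thesis using prod_parity[of "\<lambda>_. 1" "(n - m) div (m - 1) - l" l] by simp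
qed

text \<open>The vertex \<open>u\<close> stands for the point \<open>(u div p, u mod p)\<close> of the affine plane over the
  field with \<open>p\<close> elements; \<open>(x, y)\<close> and \<open>(x', y')\<close> are joined if \<open>y + y' = x x'\<close>, and only
  \<open>s\<close> of the vertical lines are used.\<close>

definition polarity_graph :: "nat \<Rightarrow> nat \<Rightarrow> nat set set" where
  "polarity_graph p s = {{u, w} | u w. u \<noteq> w \<and> u < s * p \<and> w < s * p \<and>
      [u + w = (u div p) * (w div p)] (mod p)}"

lemma polarity_graph_iff:
  "{u, w} \<in> polarity_graph p s \<longleftrightarrow> u \<noteq> w \<and> u < s * p \<and> w < s * p \<and>
      [u + w = (u div p) * (w div p)] (mod p)"
  unfolding polarity_graph_def by (auto simp: doubleton_eq_iff add.commute mult.commute)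

lemma simple_polarity_graph: "s * p \<le> n \<Longrightarrow> simple_graph n (polarity_graph p s)"
  by (auto simp: simple_graph_def polarity_graph_def card_insert_if)

text \<open>The alternating sum of the four equations cancels the second coordinates and leaves
  \<open>(U - W) * (Z - T) = 0\<close> modulo \<open>p\<close>. First coordinates lie below
  \<open>p\<close> by \<open>s \<le> p\<close>, so two of them agree, and an adjacency equation then
  identifies the points.\<close>

lemma polarity_graph_common_neighbour:
  assumes p: "prime p" "s \<le> p"
    and e: "{u, z} \<in> polarity_graph p s" "{w, z} \<in> polarity_graph p s"
           "{u, t} \<in> polarity_graph p s" "{w, t} \<in> polarity_graph p s"
  shows "u = w \<or> z = t"
proof -
  have lt: "v div p < p" if "v < s * p" for v
  proof -
    have "v div p < s" using that by (rule less_mult_imp_div_less)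
    then show ?thesis using p by simp
  qed
  have eqI: "a = b" if "[a = b] (mod p)" "a div p = b div p" for a b :: nat
    using that by (metis Cong.cong_def div_mult_mod_eq)
  define U W Z T where "U = u div p" "W = w div p" "Z = z div p" "T = t div p"
  have less: "U < p" "W < p" "Z < p" "T < p"
    using e lt by (auto simp: U_W_Z_T_def polarity_graph_iff)
  have c: "[int u + int z = int U * int Z] (mod int p)" "[int w + int z = int W * int Z] (mod int p)"
    "[int u + int t = int U * int T] (mod int p)" "[int w + int t = int W * int T] (mod int p)"
    using e unfolding U_W_Z_T_def polarity_graph_iff
    by (simp_all flip: cong_int_iff of_nat_mult of_nat_add)
  have "[(int u + int z) - (int w + int z) - ((int u + int t) - (int w + int t))
     = (int U * int Z - int W * int Z) - (int U * int T - int W * int T)] (mod int p)"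
    by (intro cong_diff c)
  then have "[(int U - int W) * (int Z - int T) = 0] (mod int p)"
    by (simp add: algebra_simps cong_sym_eq)
  then have "int p dvd (int U - int W) * (int Z - int T)" by (simp add: cong_0_iff)
  then have "int p dvd int U - int W \<or> int p dvd int Z - int T"
    using p(1) by (simp add: prime_dvd_mult_iff)
  then have "[int U = int W] (mod int p) \<or> [int Z = int T] (mod int p)"
    by (simp add: cong_iff_dvd_diff)
  then have "[U = W] (mod p) \<or> [Z = T] (mod p)" by (simp add: cong_int_iff)
  then have "U = W \<or> Z = T" using less by (auto simp: Cong.cong_def)
  then show ?thesis
  proof
    assume "U = W"
    then have "[int u + int z = int w + int z] (mod int p)"
      using c(1,2) by (metis cong_sym cong_trans)
    then have "[u = w] (mod p)" by (simp add: cong_add_rcancel cong_int_iff)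
    then show ?thesis using \<open>U = W\<close> eqI by (simp add: U_W_Z_T_def)
  next
    assume "Z = T"
    then have "[int u + int z = int u + int t] (mod int p)"
      using c(1,3) by (metis cong_sym cong_trans)
    then have "[z = t] (mod p)" by (simp add: cong_add_lcancel cong_int_iff)
    then show ?thesis using \<open>Z = T\<close> eqI by (simp add: U_W_Z_T_def)
  qed
qed

lemma polarity_graph_no_cycle:
  assumes "prime p" "s \<le> p"
  shows "\<not> has_cycle (polarity_graph p s) 4"
proof
  assume "has_cycle (polarity_graph p s) 4"
  then obtain w :: "nat \<Rightarrow> nat" where w: "\<And>i. {w i, w (Suc i)} \<in> polarity_graph p s"
     "\<And>i j. w i = w j \<longleftrightarrow> i mod 4 = j mod 4"
    by (elim has_cycleE) auto
  have "w 4 = w 0" by (simp add: w(2))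
  then have "w 0 = w 2 \<or> w 1 = w 3"
    using w(1)[of 0] w(1)[of 1] w(1)[of 2] w(1)[of 3]
    by (intro polarity_graph_common_neighbour[OF assms]) (simp_all add: insert_commute numeral_eq_Suc)
  then show False by (simp add: w(2))
qed

text \<open>Each vertical line contains exactly one solution of the equation for a given vertex.
  Avoiding the lines already visited excludes repetitions as well as loops and leaves at least
  \<open>s - l\<close> lines; the start is undercounted as \<open>p * (s - l)\<close> to give a
  clean power.\<close>

lemma polarity_graph_paths:
  assumes "p > 0" "l \<ge> 2"
  shows "p * (s - l) ^ l \<le> 2 * card (path_copies (polarity_graph p s) l)"
proof -
  define C where "C = (\<lambda>xs. {v. v < s * p \<and> v div p \<notin> (\<lambda>u. u div p) ` set xs \<and>
      (xs = [] \<or> {last xs, v} \<in> polarity_graph p s)})"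
  have nth: "xs ! j < s * p" if "xs \<in> grow C i" "j < i" for xs i j
    using nth_grow[OF that] unfolding C_def by simp
  have "(\<Prod>i<l. if i = 0 then p * (s - l) else s - l) \<le> 2 * card (path_copies (polarity_graph p s) l)"
  proof (rule prod_le_card_path_copies[where C = C])
    show "finite (polarity_graph p s)"
      using simple_polarity_graph[OF order_refl] by (rule simple_graph_finite)
    fix i xs assume i: "i < l" and xs: "xs \<in> grow C i"
    have len: "length xs = i" using xs by (rule length_grow)
    have "(if i = 0 then p * (s - l) else s - l) \<le> card (C xs)"
    proof (cases i)
      case 0
      then have "C xs = {..<s * p}" using len by (auto simp: C_def)
      then show ?thesis using 0 by (simp add: mult.commute)
    next
      case (Suc j)
      define u where "u = last xs"
      have ne: "xs \<noteq> []" using Suc len by auto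
      have u: "u < s * p" "u \<in> set xs"
        using nth[OF xs, of j] Suc len ne by (auto simp: u_def last_conv_nth)
      have "{..<s} - (\<lambda>u. u div p) ` set xs \<subseteq> (\<lambda>v. v div p) ` C xs"
      proof
        fix x assume x: "x \<in> {..<s} - (\<lambda>u. u div p) ` set xs"
        \<comment> \<open>The second coordinate of the solution on line \<open>x\<close>, computed
          in the integers as the difference may be negative.\<close>
        define y where "y = nat ((int (u div p) * int x - int u) mod int p)"
        define v where "v = x * p + y"
        have "int y = (int (u div p) * int x - int u) mod int p"
          using assms by (simp add: y_def)
        then have "[int y = int (u div p) * int x - int u] (mod int p)" by simp
        then have "[int u + int y = int u + (int (u div p) * int x - int u)] (mod int p)"
          by (intro cong_add) auto
        then have y: "[u + y = (u div p) * x] (mod p)"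
          by (simp flip: cong_int_iff)
        have "y < p" using assms by (simp add: y_def nat_less_iff)
        then have vx: "v div p = x" using assms by (simp add: v_def)
        have "u + v = u + y + x * p" by (simp add: v_def)
        then have "[u + v = u + y] (mod p)" by (simp only: Cong.cong_def mod_mult_self1)
        then have "[u + v = (u div p) * (v div p)] (mod p)" using y vx cong_trans by blast
        moreover have "v < s * p"
        proof -
          have "v < Suc x * p" using \<open>y < p\<close> by (simp add: v_def)
          also have "\<dots> \<le> s * p" using x by (intro mult_right_mono) auto
          finally show ?thesis .
        qed
        moreover have "u \<noteq> v" using x u vx by auto
        ultimately have "v \<in> C xs" using u x vx by (simp add: C_def polarity_graph_iff flip: u_def)
        then show "x \<in> (\<lambda>v. v div p) ` C xs" using vx by auto
      qed
      moreover have "finite (C xs)" by (simp add: C_def)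
      ultimately have "card ({..<s} - (\<lambda>u. u div p) ` set xs) \<le> card (C xs)" by (intro surj_card_le)
      moreover have "card {..<s} - card ((\<lambda>u. u div p) ` set xs) \<le> card ({..<s} - (\<lambda>u. u div p) ` set xs)"
        by (intro diff_card_le_card_Diff) auto
      moreover have "card ((\<lambda>u. u div p) ` set xs) \<le> card (set xs)" by (intro card_image_le) auto
      moreover have "card (set xs) \<le> l" using card_length[of xs] len i by simp
      ultimately show ?thesis using Suc by simp
    qed
    then show "finite (C xs) \<and> (if i = 0 then p * (s - l) else s - l) \<le> card (C xs)"
      by (simp add: C_def)
  next
    fix i xs y assume i: "Suc i < l" and xs: "xs \<in> grow C (Suc i)" and y: "y \<in> C xs"
    have len: "length xs = Suc i" using xs by (rule length_grow)
    then have "xs \<noteq> []" by auto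
    then have "last xs = xs ! i" using len by (simp add: last_conv_nth)
    then show "y \<notin> set xs \<and> {xs ! i, y} \<in> polarity_graph p s"
      using y \<open>xs \<noteq> []\<close> by (auto simp: C_def)
  qed fact
  also have "(\<Prod>i<l. if i = 0 then p * (s - l) else s - l) = p * (s - l) ^ l"
    using assms(2) by (cases l) (simp_all add: prod.lessThan_Suc_shift del: prod.lessThan_Suc)
  finally show ?thesis .
qed

section \<open>Asymptotics\<close>

text \<open>Absorbs bounded losses, from rounding and from vertices already used, into the factor
  \<open>1 - \<epsilon>\<close>.\<close>

lemma eventually_shifted_power_ge:
  fixes b :: real
  assumes "\<epsilon> > 0"
  shows "\<forall>\<^sub>F n in sequentially. (1 - \<epsilon>) * real n ^ d \<le> (real n - b) ^ d"
proof -
  have "(\<lambda>n. (real n - b) / real n) \<longlonglongrightarrow> 1" by real_asymp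
  then have "(\<lambda>n. ((real n - b) / real n) ^ d) \<longlonglongrightarrow> 1 ^ d" by (rule tendsto_power)
  then have "\<forall>\<^sub>F n in sequentially. 1 - \<epsilon> < ((real n - b) / real n) ^ d"
    using assms by (intro order_tendstoD) auto
  then show ?thesis
    using eventually_gt_at_top[of 0]
    by eventually_elim (simp add: power_divide field_simps)
qed

lemma ex_lower_complete_bipartite:
  assumes "k \<ge> 2" "l \<ge> 2" "l < 2 * k" "\<epsilon> > 0"
  shows "\<forall>\<^sub>F n in sequentially. real (ex_path_cycle n l (2 * k)) \<ge>
     (1 - \<epsilon>) * ((1/2) * ffac (real k - 1) (l div 2) * real n ^ ((l + 1) div 2))"
proof -
  define r d where "r = k - 1" and "d = (l + 1) div 2"
  define F where "F = ffac (real k - 1) (l div 2)"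
  have "real (\<Prod>j<l div 2. r - j) = (\<Prod>j<l div 2. real (r - j))" by simp
  also have "\<dots> = F"
    \<comment> \<open>Since \<open>l < 2 * k\<close>, every \<open>j < l div 2\<close> is below
      \<open>k - 1\<close>, so no subtraction is truncated.\<close>
    unfolding F_def ffac_def r_def using assms by (intro prod.cong) (auto simp: of_nat_diff)
  finally have F: "real (\<Prod>j<l div 2. r - j) = F" .
  then have F0: "F \<ge> 0" by (metis of_nat_0_le_iff)
  show ?thesis
    using eventually_shifted_power_ge[OF assms(4), of d "real (r + l)"] eventually_ge_at_top[of "r + l"]
    unfolding F_def [symmetric] d_def [symmetric]
  proof eventually_elim
    case (elim n)
    have "(\<Prod>j<l div 2. r - j) * (n - r - l) ^ d \<le> 2 * card (path_copies (complete_bipartite r n) l)"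
      using complete_bipartite_paths[OF assms(2)] by (simp add: d_def)
    also have "\<dots> \<le> 2 * ex_path_cycle n l (2 * k)"
      using simple_complete_bipartite complete_bipartite_no_cycle[of r k] assms(1)
      by (intro mult_left_mono card_path_copies_le_ex) (auto simp: r_def)
    finally have "real ((\<Prod>j<l div 2. r - j) * (n - r - l) ^ d) \<le> real (2 * ex_path_cycle n l (2 * k))"
      by (rule of_nat_mono)
    then have "F * (real n - real (r + l)) ^ d \<le> 2 * real (ex_path_cycle n l (2 * k))"
      using elim(2) unfolding of_nat_mult F of_nat_power by (simp add: of_nat_diff algebra_simps)
    moreover have "F * ((1 - \<epsilon>) * real n ^ d) \<le> F * (real n - real (r + l)) ^ d"
      using elim(1) F0 by (rule mult_left_mono)
    ultimately show ?case by (simp add: algebra_simps)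
  qed
qed

text \<open>Having \<open>m - 1\<close> classes instead of \<open>m\<close> gains enough to pay for
  the factor 2 lost to the two orientations of a path.\<close>

lemma two_mult_power_le:
  assumes "m \<ge> 2" "d \<ge> m"
  shows "2 * (real m - 1) ^ d \<le> real m ^ d"
proof -
  have "0 \<le> 1 / (real m - 1)" using assms by simp
  then have "1 + real d * (1 / (real m - 1)) \<le> (1 + 1 / (real m - 1)) ^ d"
    by (intro Bernoulli_inequality) linarith
  moreover have "1 \<le> real d * (1 / (real m - 1))" using assms by (simp add: field_simps)
  ultimately have "2 \<le> (1 + 1 / (real m - 1)) ^ d" by linarith
  also have "1 + 1 / (real m - 1) = real m / (real m - 1)" using assms by (simp add: field_simps)
  finally show ?thesis using assms by (simp add: power_divide field_simps)
qed

lemma ex_lower_hub_path: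
  assumes "k \<ge> 3" "l \<ge> 2 * k" "\<epsilon> > 0"
  shows "\<forall>\<^sub>F n in sequentially. real (ex_path_cycle n l (2 * k)) \<ge>
     (1 - \<epsilon>) * (real n / real (l div 2)) ^ ((l + 1) div 2)"
proof -
  define m d where "m = l div 2" and "d = (l + 1) div 2"
  have m: "m \<ge> 3" "d \<ge> m" "l \<le> 2 * m + 1" using assms by (auto simp: m_def d_def)
  \<comment> \<open>Collects the losses: \<open>m\<close> hubs, \<open>m - 1\<close> from rounding
    in the division, and \<open>l\<close> used vertices in each of the \<open>m - 1\<close>
    classes.\<close>
  define b where "b = real m + (real m - 1) * (real l + 1)"
  show ?thesis
    using eventually_shifted_power_ge[OF assms(3), of d b] eventually_ge_at_top[of "nat \<lceil>b\<rceil>"]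
      eventually_ge_at_top[of m]
    unfolding m_def [symmetric] d_def [symmetric]
  proof eventually_elim
    case (elim n)
    define N where "N = (n - m) div (m - 1)"
    have nb: "real n \<ge> b" using elim(2) by linarith
    have "n - m < (m - 1) * N + (m - 1)" unfolding N_def using m dividend_less_times_div[of "m - 1" "n - m"] by linarith
    then have "real (n - m) \<le> real ((m - 1) * N + (m - 1))" by (intro of_nat_mono) simp
    then have "real n - real m \<le> (real m - 1) * real N + (real m - 1)"
      using elim(3) m by (simp add: of_nat_diff)
    then have "(real n - b) \<le> (real m - 1) * (real N - real l)" by (simp add: b_def algebra_simps)
    also have "\<dots> \<le> (real m - 1) * real (N - l)" using m by (intro mult_left_mono) auto
    finally have "(real n - b) ^ d \<le> ((real m - 1) * real (N - l)) ^ d"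
      using nb by (intro power_mono) auto
    also have "\<dots> = (real m - 1) ^ d * real ((N - l) ^ d)" by (simp add: power_mult_distrib)
    also have "(N - l) ^ d \<le> 2 * card (path_copies (hub_path m n) l)"
      unfolding N_def d_def using m assms by (intro hub_path_paths) auto
    also have "\<dots> \<le> 2 * ex_path_cycle n l (2 * k)"
      using simple_hub_path hub_path_no_cycle[OF assms(1)] by (intro mult_left_mono card_path_copies_le_ex) auto
    finally have "(real n - b) ^ d \<le> (2 * (real m - 1) ^ d) * real (ex_path_cycle n l (2 * k))"
      using m by (simp add: mult_left_mono mult_ac)
    also have "\<dots> \<le> real m ^ d * real (ex_path_cycle n l (2 * k))"
      using two_mult_power_le[of m d] m by (intro mult_right_mono) auto
    finally have "(1 - \<epsilon>) * real n ^ d \<le> real m ^ d * real (ex_path_cycle n l (2 * k))"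
      using elim(1) by linarith
    then show ?case using m by (simp add: power_divide field_simps)
  qed
qed

text \<open>Here \<open>x\<close> stands for \<open>sqrt n\<close>. For even \<open>l\<close> the
  target has degree \<open>l\<close>, one less than the path count, so any positive limit
  \<open>c\<close> suffices; for odd \<open>l\<close> the degrees agree and the constants must be
  compared.\<close>

lemma eventually_dominates_target:
  fixes f :: "real \<Rightarrow> real"
  assumes f: "(f \<longlongrightarrow> c) at_top" and "c > 0" and "l \<ge> 4"
    and odd: "odd l \<Longrightarrow> 2 / real (l div 2) ^ ((l + 1) div 2) < c"
  shows "\<forall>\<^sub>F x in at_top. 2 * (x\<^sup>2 / real (l div 2)) ^ ((l + 1) div 2) \<le> f x * x ^ (l + 1)"
proof -
  define m d where "m = l div 2" and "d = (l + 1) div 2"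
  have m: "m > 0" using assms(3) by (auto simp: m_def)
  have "\<forall>\<^sub>F x in at_top. 2 / real m ^ d * x ^ (2 * d) \<le> f x * x ^ (l + 1)"
  proof (cases "odd l")
    case True
    then have "2 * d = l + 1" by (simp add: d_def)
    have "2 / real m ^ d < c" using odd[OF True] by (simp add: m_def d_def)
    then have "\<forall>\<^sub>F x in at_top. 2 / real m ^ d < f x" by (rule order_tendstoD(1)[OF f])
    then show ?thesis
      using eventually_ge_at_top[of 0]
      unfolding \<open>2 * d = l + 1\<close>
      by eventually_elim (intro mult_right_mono; simp)
  next
    case False
    then have "2 * d = l" by (simp add: d_def)
    have "\<forall>\<^sub>F x in at_top. c / 2 < f x" using assms(2) by (intro order_tendstoD(1)[OF f]) auto
    moreover have "\<forall>\<^sub>F x in at_top. 2 / real m ^ d \<le> c / 2 * x" using assms(2) by real_asymp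
    ultimately show ?thesis
      using eventually_ge_at_top[of 0]
      unfolding \<open>2 * d = l\<close>
    proof eventually_elim
      case (elim x)
      have "c / 2 * x \<le> f x * x" using elim by (intro mult_right_mono) auto
      then have "2 / real m ^ d \<le> f x * x" using elim by linarith
      then have "2 / real m ^ d * x ^ l \<le> f x * x * x ^ l" using elim by (intro mult_right_mono) auto
      then show ?case by (simp add: mult_ac)
    qed
  qed
  then show ?thesis
    unfolding m_def [symmetric] d_def [symmetric] by (simp add: power_divide power_mult)
qed

lemma ex_lower_polarity_graph:
  assumes "l \<ge> 4"
  shows "\<forall>\<^sub>F n in sequentially. real (ex_path_cycle n l 4) \<ge> (real n / real (l div 2)) ^ ((l + 1) div 2)"
proof -
  define m d where "m = l div 2" and "d = (l + 1) div 2"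
  have m: "m \<ge> 2" using assms by (auto simp: m_def)
  \<comment> \<open>Normalised path counts: \<open>f1\<close> for a prime
    \<open>p \<le> sqrt n\<close> with \<open>s = p\<close>, and \<open>f2\<close> for a larger
    prime with \<open>s = n div p\<close>.\<close>
  define f1 f2 :: "real \<Rightarrow> real"
    where "f1 = (\<lambda>x. 4/5 * (4/5 - real l / x) ^ l)"
      and "f2 = (\<lambda>x. (1 - 7/5 * (real l + 1) / x) * (5/7 - (real l + 1) / x) ^ (l - 1))"
  have "(f1 \<longlongrightarrow> 4/5 * (4/5 - 0) ^ l) at_top"
    unfolding f1_def by (intro tendsto_intros) real_asymp
  then have f1: "(f1 \<longlongrightarrow> (4/5) ^ (l + 1)) at_top" by simp
  have "(f2 \<longlongrightarrow> (1 - 0) * (5/7 - 0) ^ (l - 1)) at_top"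
    unfolding f2_def by (intro tendsto_intros; real_asymp)
  then have f2: "(f2 \<longlongrightarrow> (5/7) ^ (l - 1)) at_top" by simp
  have odd1: "2 / real m ^ d < (4/5) ^ (l + 1)" if "odd l"
  proof -
    have d: "l + 1 = 2 * d" "d = Suc m" using that by (auto simp: d_def m_def)
    \<comment> \<open>The tight case is \<open>m = 2\<close>, \<open>d = 3\<close>, where
      \<open>(32/25) ^ 3\<close> is about 2.097.\<close>
    have "2 < (16/25 * real m) ^ d"
    proof (cases "m = 2")
      case True
      then show ?thesis using d by (simp add: power_numeral_reduce)
    next
      case False
      then have "48/25 \<le> 16/25 * real m" using m by simp
      then have "(48/25) ^ 2 \<le> (16/25 * real m) ^ 2" by (intro power_mono) auto
      also have "\<dots> \<le> (16/25 * real m) ^ d" using d m False by (intro power_increasing) auto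
      finally show ?thesis by (simp add: power2_eq_square)
    qed
    also have "\<dots> = (4/5) ^ (l + 1) * real m ^ d"
      unfolding d(1) by (simp add: power_mult power_mult_distrib power_divide power2_eq_square)
    finally show ?thesis using m by (simp add: field_simps)
  qed
  have odd2: "2 / real m ^ d < (5/7) ^ (l - 1)" if "odd l"
  proof -
    have d: "l - 1 = 2 * m" "d = Suc m" using that by (auto simp: d_def m_def)
    \<comment> \<open>Here the upper ratio \<open>7/5\<close> matters: its square
      \<open>49/25\<close> is just below 2.\<close>
    have "1 < 25/49 * real m" using m by simp
    then have "1 < (25/49 * real m) ^ m" using m by (intro one_less_power) auto
    then have "2 * 1 < real m * (25/49 * real m) ^ m" using m by (intro mult_le_less_imp_less) auto
    also have "\<dots> = (5/7) ^ (l - 1) * real m ^ d"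
      unfolding d by (simp add: power_mult power_mult_distrib power_divide power2_eq_square)
    finally show ?thesis using m by (simp add: field_simps)
  qed
  have "\<forall>\<^sub>F x in at_top. 2 * (x\<^sup>2 / real m) ^ d \<le> f1 x * x ^ (l + 1)"
    unfolding m_def d_def
    by (rule eventually_dominates_target[OF f1 _ assms]) (use odd1 in \<open>simp_all add: m_def d_def\<close>)
  moreover have "\<forall>\<^sub>F x in at_top. 2 * (x\<^sup>2 / real m) ^ d \<le> f2 x * x ^ (l + 1)"
    unfolding m_def d_def
    by (rule eventually_dominates_target[OF f2 _ assms]) (use odd2 in \<open>simp_all add: m_def d_def\<close>)
  ultimately have "\<forall>\<^sub>F x in at_top. 2 * (real l + 1) \<le> x \<and> 2 * (x\<^sup>2 / real m) ^ d \<le> f1 x * x ^ (l + 1) \<and>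
     2 * (x\<^sup>2 / real m) ^ d \<le> f2 x * x ^ (l + 1) \<and> (\<exists>p. prime p \<and> 4/5 * x \<le> real p \<and> real p \<le> 7/5 * x)"
    using prime_in_interval eventually_ge_at_top[of "2 * (real l + 1)"] by eventually_elim blast
  moreover have "filterlim (\<lambda>n. sqrt (real n)) at_top sequentially" by real_asymp
  ultimately have "\<forall>\<^sub>F n in sequentially. 2 * (real l + 1) \<le> sqrt (real n) \<and>
     2 * ((sqrt (real n))\<^sup>2 / real m) ^ d \<le> f1 (sqrt (real n)) * sqrt (real n) ^ (l + 1) \<and>
     2 * ((sqrt (real n))\<^sup>2 / real m) ^ d \<le> f2 (sqrt (real n)) * sqrt (real n) ^ (l + 1) \<and>
     (\<exists>p. prime p \<and> 4/5 * sqrt (real n) \<le> real p \<and> real p \<le> 7/5 * sqrt (real n))"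
    by (rule eventually_compose_filterlim)
  then show ?thesis
    unfolding m_def [symmetric] d_def [symmetric]
  proof eventually_elim
    case (elim n)
    define x where "x = sqrt (real n)"
    have x2: "x\<^sup>2 = real n" by (simp add: x_def)
    have x: "2 * (real l + 1) \<le> x" "2 * (real n / real m) ^ d \<le> f1 x * x ^ (l + 1)"
       "2 * (real n / real m) ^ d \<le> f2 x * x ^ (l + 1)"
      using elim by (simp_all add: x_def)
    have "0 < 2 * (real l + 1)" by simp
    then have x0: "x > 0" using x(1) by (rule less_le_trans)
    obtain p where p: "prime p" "4/5 * x \<le> real p" "real p \<le> 7/5 * x"
      using elim by (auto simp: x_def)
    have p0: "p > 0" using p(1) by (rule prime_gt_0_nat)
    have "\<exists>s\<le>p. s * p \<le> n \<and> 2 * (real n / real m) ^ d \<le> real p * real (s - l) ^ l"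
    proof (cases "real p \<le> x")
      case True
      then have "real p ^ 2 \<le> x\<^sup>2" by (intro power_mono) auto
      then have "p * p \<le> n" unfolding x2 by (simp add: power2_eq_square flip: of_nat_mult)
      have "f1 x * x ^ (l + 1) = (4/5 * x) * ((4/5 - real l / x) * x) ^ l"
        by (simp add: f1_def power_mult_distrib)
      also have "(4/5 - real l / x) * x = 4/5 * x - real l" using x0 by (simp add: field_simps)
      also have "(4/5 * x) * (4/5 * x - real l) ^ l \<le> real p * real (p - l) ^ l"
        using p x(1) x0 by (intro mult_mono power_mono) auto
      finally show ?thesis using x(2) \<open>p * p \<le> n\<close> by (intro exI[of _ p]) auto
    next
      case False
      define s where "s = n div p"
      have "s * p \<le> n" by (simp add: s_def)
      have "n < p * s + p" unfolding s_def using dividend_less_times_div[OF p0, of n] by simp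
      then have ns: "x\<^sup>2 \<le> real p * real s + real p"
        unfolding x2 by (simp flip: of_nat_mult of_nat_add)
      have "s \<le> p"
      proof -
        have "x\<^sup>2 \<le> real p ^ 2" using False x0 by (intro power_mono) auto
        then have "n \<le> p * p" unfolding x2 by (simp add: power2_eq_square flip: of_nat_mult)
        then have "s \<le> (p * p) div p" unfolding s_def by (rule div_le_mono)
        then show ?thesis using p0 by simp
      qed
      have sl: "real s - real l \<le> real (s - l)" by simp
      \<comment> \<open>The product \<open>p * s\<close> is close to \<open>n\<close> for every
        \<open>p\<close>, so one factor \<open>s - l\<close> is paired with \<open>p\<close>; only
        the other \<open>l - 1\<close> factors use the weaker bound \<open>5/7 x\<close>.\<close>
      have 1: "x\<^sup>2 - 7/5 * (real l + 1) * x \<le> real p * real (s - l)"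
      proof -
        have "(real l + 1) * real p \<le> (real l + 1) * (7/5 * x)" using p by (intro mult_left_mono) auto
        also have "\<dots> = 7/5 * (real l + 1) * x" by simp
        finally have "(real l + 1) * real p \<le> 7/5 * (real l + 1) * x" .
        then have "x\<^sup>2 - 7/5 * (real l + 1) * x \<le> real p * real s + real p - (real l + 1) * real p"
          using ns by linarith
        also have "\<dots> = real p * (real s - real l)" by (simp add: algebra_simps)
        also have "\<dots> \<le> real p * real (s - l)" using sl by (intro mult_left_mono) auto
        finally show ?thesis .
      qed
      have 2: "5/7 * x - (real l + 1) \<le> real (s - l)"
      proof -
        have "x * x \<le> real p * (real s + 1)" using ns by (simp add: power2_eq_square algebra_simps)
        also have "\<dots> \<le> 7/5 * x * (real s + 1)" using p by (intro mult_right_mono) auto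
        finally have "x * x \<le> x * (7/5 * (real s + 1))" by (simp add: mult_ac)
        then have "x \<le> 7/5 * (real s + 1)" using x0 by simp
        then have "5/7 * x \<le> 5/7 * (7/5 * (real s + 1))" by (intro mult_left_mono) auto
        also have "\<dots> = real s + 1" by simp
        finally have "5/7 * x - (real l + 1) \<le> real s + 1 - (real l + 1)" by (rule diff_right_mono)
        also have "\<dots> = real s - real l" by simp
        finally show ?thesis using sl by (rule order_trans)
      qed
      have "f2 x * x ^ (l + 1) = ((1 - 7/5 * (real l + 1) / x) * x\<^sup>2) * ((5/7 - (real l + 1) / x) * x) ^ (l - 1)"
        using assms by (cases l) (simp_all add: f2_def power_mult_distrib power2_eq_square)
      also have "(1 - 7/5 * (real l + 1) / x) * x\<^sup>2 = x\<^sup>2 - 7/5 * (real l + 1) * x"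
        using x0 by (simp add: field_simps power2_eq_square)
      also have "(5/7 - (real l + 1) / x) * x = 5/7 * x - (real l + 1)"
        using x0 by (simp add: field_simps)
      also have "(x\<^sup>2 - 7/5 * (real l + 1) * x) * (5/7 * x - (real l + 1)) ^ (l - 1)
         \<le> (real p * real (s - l)) * real (s - l) ^ (l - 1)"
        using 1 2 x(1) by (intro mult_mono power_mono) auto
      also have "\<dots> = real p * real (s - l) ^ l" using assms by (cases l) auto
      finally show ?thesis using x(3) \<open>s \<le> p\<close> \<open>s * p \<le> n\<close> by (intro exI[of _ s]) auto
    qed
    then obtain s where s: "s \<le> p" "s * p \<le> n" "2 * (real n / real m) ^ d \<le> real p * real (s - l) ^ l"
      by blast
    have "p * (s - l) ^ l \<le> 2 * card (path_copies (polarity_graph p s) l)"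
      using p0 assms by (intro polarity_graph_paths) auto
    also have "\<dots> \<le> 2 * ex_path_cycle n l 4"
      using simple_polarity_graph[OF s(2)] polarity_graph_no_cycle[OF p(1) s(1)]
      by (intro mult_left_mono card_path_copies_le_ex) auto
    finally have "real (p * (s - l) ^ l) \<le> real (2 * ex_path_cycle n l 4)" by (rule of_nat_mono)
    then show ?case using s(3) by simp
  qed
qed

theorem theorem18:
  fixes k l :: nat
  assumes "k \<ge> 2" and "l \<ge> 2"
  shows "(l < 2 * k \<longrightarrow>
           (\<forall>\<epsilon>>0. \<forall>\<^sub>F n in sequentially.
              real (ex_path_cycle n l (2 * k)) \<ge>
                (1 - \<epsilon>) * ((1/2) * ffac (real k - 1) (l div 2) * real n ^ ((l + 1) div 2))))
       \<and> (l \<ge> 2 * k \<longrightarrow>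
           (\<forall>\<epsilon>>0. \<forall>\<^sub>F n in sequentially.
              real (ex_path_cycle n l (2 * k)) \<ge>
                (1 - \<epsilon>) * max ((real n / real (l div 2)) ^ ((l + 1) div 2))
                   (((real k - 1) / (4 * (real k - 2) ^ (k + 2))) ^ ((l + 1) div 2)
                      * ffac (real k - 1) (l div 2) * real n ^ ((l + 1) div 2))))"
proof (intro conjI impI allI)
  fix \<epsilon> :: real
  assume "l < 2 * k" "\<epsilon> > 0"
  then show "\<forall>\<^sub>F n in sequentially. real (ex_path_cycle n l (2 * k)) \<ge>
      (1 - \<epsilon>) * ((1/2) * ffac (real k - 1) (l div 2) * real n ^ ((l + 1) div 2))"
    using assms by (intro ex_lower_complete_bipartite)
next
  fix \<epsilon> :: real
  assume l: "2 * k \<le> l" and \<epsilon>: "\<epsilon> > 0"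
  have "\<exists>i\<in>{..<l div 2}. real k - 1 - real i = 0"
    using l assms(1) by (intro bexI[of _ "k - 1"]) auto
  then have ffac_0: "ffac (real k - 1) (l div 2) = 0"
    unfolding ffac_def by (intro prod_zero) auto
  \<comment> \<open>The second argument is zero, also for \<open>k = 2\<close>, where the quotient
    is a division by zero with value 0.\<close>
  have max: "max ((real n / real (l div 2)) ^ ((l + 1) div 2))
      (((real k - 1) / (4 * (real k - 2) ^ (k + 2))) ^ ((l + 1) div 2)
        * ffac (real k - 1) (l div 2) * real n ^ ((l + 1) div 2))
      = (real n / real (l div 2)) ^ ((l + 1) div 2)" for n
    by (simp add: ffac_0 max_absorb1)
  show "\<forall>\<^sub>F n in sequentially. real (ex_path_cycle n l (2 * k)) \<ge>
      (1 - \<epsilon>) * max ((real n / real (l div 2)) ^ ((l + 1) div 2))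
        (((real k - 1) / (4 * (real k - 2) ^ (k + 2))) ^ ((l + 1) div 2)
          * ffac (real k - 1) (l div 2) * real n ^ ((l + 1) div 2))"
  proof (cases "k = 2")
    case True
    then have "l \<ge> 4" using l by simp
    from ex_lower_polarity_graph[OF this] show ?thesis
      unfolding max
    proof eventually_elim
      case (elim n)
      have "(1 - \<epsilon>) * (real n / real (l div 2)) ^ ((l + 1) div 2) \<le> 1 * (real n / real (l div 2)) ^ ((l + 1) div 2)"
        using \<epsilon> by (intro mult_right_mono) auto
      also have "\<dots> \<le> real (ex_path_cycle n l (2 * k))" using elim True by simp
      finally show ?case .
    qed
  next
    case False
    then show ?thesis unfolding max using assms(1) l \<epsilon> by (intro ex_lower_hub_path) auto
  qed
qed

end
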